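(* Let $n,N\ge1$ be integers and $0<q<1$. Let $\emptyset=c^{[0]}\prec c^{[1]}\prec\cdots\prec c^{[N]}$ be the random sequence of colour sequences ($c^{[k]}\in\mathcal C_k$) generated by $N$ successive applications, starting from $c^{[0]}=\emptyset$, of the Markov kernel $$\mathbb P_{\rm col}\big(c^{[m]}\to c^{[m+1]}\big)=\mathbf 1_{c^{[m]}\prec c^{[m+1]}}(-1)^n q^{\binom{nm+n+1}{2}-\binom{nm+1}{2}-\xi(c^{[m]};c^{[m+1]})}\frac{(1-q)^{nm}}{(q;q)_n^{2m+1}}\,\frac{g^{c^{[m+1]}}_{\Delta}\big((m+1)^n;\vec Q^{[m+1]}\big)}{g^{c^{[m]}}_{\Delta}\big(m^n;\vec Q^{[m]}\big)} .$$ Then this array has joint distribution $$\mathbb P_{\rm col}\big(c^{[1]}\prec\cdots\prec c^{[N]}\big)=\mathbf 1_{c^{[1]}\prec\cdots\prec c^{[N]}}(-1)^{nN}q^{\binom{nN+1}{2}}\frac{(1-q)^{n\binom N2}}{(q;q)_n^{N^2}}\,g^{c^{[N]}}_\Delta\big(N^n;\vec Q^{[N]}\big)\prod_{i=1}^{N}q^{-\xi(c^{[i-1]};c^{[i]})}.$$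
   Context: **Colour sequences and interlacing.** $\mathcal C_m$ is the set of $c\in\{1,\dots,n\}^{nm}$ in which each colour occurs exactly $m$ times ($\mathcal C_0=\{\emptyset\}$). Given $c\in\mathcal C_m$, $c'\in\mathcal C_{m+1}$, take a line of $n(2m+1)$ positions, split into $n$ consecutive bundles of $2m+1$ positions; in each bundle the positions carry alternately top and bottom arrows, beginning and ending with a top arrow. Colour the top arrows, from left to right along the line, by $c'_1,c'_2,\dots,c'_{n(m+1)}$, and the bottom arrows, from left to right, by $c_1,\dots,c_{nm}$. Write $c\prec c'$ if for each colour $a$ the $m+1$ top arrows and $m$ bottom arrows of colour $a$ alternate along the line (beginning and ending with a top arrow). (Equivalently: if one path of each colour enters from the far right and a path of colour $c_i$ enters at each bottom arrow, all paths travel left and leave through top arrows of their colour, no colour ever occupies a horizontal edge more than once, and nothing exits at the far left.) If $c\prec c'$, then $\xi(c;c')$ is the number of pairs $(\beta,a)$ with $\beta$ a bottom arrow and $a$ a colour strictly larger than the colour of $\beta$, such that a path of colour $a$ passes over $\beta$, i.e. $1+\#\{\text{bottom arrows of colour }a\text{ to the right of }\beta\}-\#\{\text{top arrows of colour }a\text{ to the right of }\beta\}=1$ (this quantity is always $0$ or $1$). Quantities containing $\mathbf 1_{c\prec c'}$ are zero if $c\not\prec c'$. **The functions $g^\sigma_\Delta$ (at $s=0$).** For $\sigma\in\mathcal C_m$, $g^\sigma_\Delta(m^n;x_1,\dots,x_{nm})$ is the partition function of the lattice with columns $0,\dots,m-1$ (left to right) and rows $1,\dots,nm$ (bottom to top,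 parameter $x_a$ in row $a$), vertical edges labelled by $\{0,1\}^n$, horizontal edges by $\{0,1,\dots,n\}$; paths move up and left. Boundary: bottom label of every column is $(1,\dots,1)$, top label of every column is $(0,\dots,0)$, right label of every row is $0$, left label of row $a$ is $\sigma_a$. A vertex with bottom $A$, right $b$, top $C$, left $d$ in a row with parameter $x$ has weight $0$ unless $A+e_b=C+e_d$ ($e_0=0$, $e_i$ the standard unit vectors), and otherwise, with $|A|=\sum_kA_k$ and $A_{(i,n]}=\sum_{k>i}A_k$: $(b,d)=(0,0)$: $q^{-|A|}$; $(i,i)$ with $i\ge1$: $(-1)^{A_i}x\,q^{-A_{(i,n]}}$; $(0,i)$, $i\ge1$: $(1-q^{-A_i})q^{-A_{(i,n]}}$; $(i,0)$, $i\ge1$: $-x\,q^{-|A|}$; $(j,i)$ with $1\le i<j$: $(q^{-A_i}-1)q^{-A_{(i,n]}}x$; $(i,j)$ with $1\le i<j$: $0$. The partition function is the sum over edge configurations of the product of vertex weights. For $m=0$, $g^\emptyset_\Delta=1$. Finally $\vec Q^{[m]}=(\underbrace{q^{n-1},\dots,q^{n-1}}_{m},\dots,\underbrace{q,\dots,q}_{m},\underbrace{1,\dots,1}_{m})$ and $(q;q)_n=\prod_{k=1}^n(1-q^k)$. *)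

theory Defs
  imports "HOL-Probability.Probability_Mass_Function"
begin

text \<open>
  Colours are the numbers 1, ..., \<open>n\<close>. List positions, positions on the line of arrows and lattice
  rows are counted from 0.
\<close>

definition colour_seqs :: "nat \<Rightarrow> nat \<Rightarrow> nat list set" where
  "colour_seqs n m =
     {c. length c = n * m \<and> set c \<subseteq> {1..n} \<and> (\<forall>a\<in>{1..n}. count_list c a = m)}"


section \<open>Interlacing\<close>

text \<open>
  The line has the positions \<open>{..<n * (2 * m + 1)}\<close>, in bundles of \<open>2 * m + 1\<close>; an arrow is
  either a top or a bottom arrow.
\<close>

definition is_top :: "nat \<Rightarrow> nat \<Rightarrow> bool" where
  "is_top m p \<longleftrightarrow> even (p mod (2 * m + 1))"

definition arrow_colour :: "nat \<Rightarrow> nat list \<Rightarrow> nat list \<Rightarrow> nat \<Rightarrow> nat" where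
  "arrow_colour m c c' p =
     (if is_top m p then c' ! card {p'. p' < p \<and> is_top m p'}
      else c ! card {p'. p' < p \<and> \<not> is_top m p'})"

text \<open>
  Listing the arrows of colour \<open>a\<close> from left to right, their types have to be
  top, bottom, top, ..., bottom, top, which is the list \<open>map even [0..<2 * m + 1]\<close>.
\<close>

definition interlaces :: "nat \<Rightarrow> nat \<Rightarrow> nat list \<Rightarrow> nat list \<Rightarrow> bool" where
  "interlaces n m c c' \<longleftrightarrow>
     (\<forall>a\<in>{1..n}.
        map (is_top m) (filter (\<lambda>p. arrow_colour m c c' p = a) [0..<n * (2 * m + 1)])
          = map even [0..<2 * m + 1])"

definition passes_over :: "nat \<Rightarrow> nat \<Rightarrow> nat list \<Rightarrow> nat list \<Rightarrow> nat \<Rightarrow> nat \<Rightarrow> bool" where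
  "passes_over n m c c' a \<beta> \<longleftrightarrow>
     1 + int (card {p. \<beta> < p \<and> p < n * (2 * m + 1) \<and> \<not> is_top m p \<and> arrow_colour m c c' p = a})
       - int (card {p. \<beta> < p \<and> p < n * (2 * m + 1) \<and> is_top m p \<and> arrow_colour m c c' p = a})
     = 1"

definition xi :: "nat \<Rightarrow> nat \<Rightarrow> nat list \<Rightarrow> nat list \<Rightarrow> nat" where
  "xi n m c c' =
     card {(\<beta>, a). \<beta> < n * (2 * m + 1) \<and> \<not> is_top m \<beta> \<and> a \<in> {1..n}
             \<and> arrow_colour m c c' \<beta> < a \<and> passes_over n m c c' a \<beta>}"


section \<open>The lattice partition function\<close>

text \<open>
  A vertex has bottom label \<open>A\<close>, right label \<open>b\<close>, top label \<open>C\<close> and left label \<open>d\<close>.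
\<close>

definition vertex_weight ::
  "nat \<Rightarrow> real \<Rightarrow> real \<Rightarrow> (nat \<Rightarrow> nat) \<Rightarrow> nat \<Rightarrow> (nat \<Rightarrow> nat) \<Rightarrow> nat \<Rightarrow> real" where
  "vertex_weight n q x A b C d =
     (let total = (\<Sum>k\<in>{1..n}. A k); above = (\<lambda>i. \<Sum>k\<in>{i<..n}. A k) in
      if \<not> (\<forall>k\<in>{1..n}. A k + of_bool (b = k) = C k + of_bool (d = k)) then 0
      else if b = 0 \<and> d = 0 then q powi (- int total)
      else if b = d then (-1) ^ A b * x * q powi (- int (above b))
      else if b = 0 then (1 - q powi (- int (A d))) * q powi (- int (above d))
      else if d = 0 then - x * q powi (- int total)
      else if d < b then (q powi (- int (A d)) - 1) * q powi (- int (above d)) * x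
      else 0)"

text \<open>
  An edge configuration is a pair \<open>(V, H)\<close>. The vertex in column \<open>j < m\<close> and row \<open>r < n * m\<close> has
  bottom label \<open>V (j, r)\<close>, top label \<open>V (j, Suc r)\<close>, left label \<open>H (r, j)\<close> and right label
  \<open>H (r, Suc j)\<close>.
\<close>

definition edge_configs ::
  "nat \<Rightarrow> nat \<Rightarrow> nat list \<Rightarrow> ((nat \<times> nat \<Rightarrow> nat \<Rightarrow> nat) \<times> (nat \<times> nat \<Rightarrow> nat)) set" where
  "edge_configs n m \<sigma> =
     {(V, H).
        V \<in> ({..<m} \<times> {..n * m}) \<rightarrow>\<^sub>E ({1..n} \<rightarrow>\<^sub>E {0, 1}) \<and>
        H \<in> ({..<n * m} \<times> {..m}) \<rightarrow>\<^sub>E {0..n} \<and>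
        (\<forall>j<m. \<forall>k\<in>{1..n}. V (j, 0) k = 1 \<and> V (j, n * m) k = 0) \<and>
        (\<forall>r<n * m. H (r, m) = 0 \<and> H (r, 0) = \<sigma> ! r)}"

text \<open>
  \<open>g_Delta n q m \<sigma> x\<close> is $g^\sigma_\Delta(m^n; x_1, \dots, x_{nm})$. For \<open>m = 0\<close> there is exactly one
  (empty) configuration, and the value is 1.
\<close>

definition g_Delta :: "nat \<Rightarrow> real \<Rightarrow> nat \<Rightarrow> nat list \<Rightarrow> real list \<Rightarrow> real" where
  "g_Delta n q m \<sigma> x =
     (\<Sum>(V, H)\<in>edge_configs n m \<sigma>. \<Prod>r<n * m. \<Prod>j<m.
        vertex_weight n q (x ! r) (V (j, r)) (H (r, Suc j)) (V (j, Suc r)) (H (r, j)))"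

definition Q_vec :: "nat \<Rightarrow> real \<Rightarrow> nat \<Rightarrow> real list" where
  "Q_vec n q m = concat (map (\<lambda>k. replicate m (q ^ k)) (rev [0..<n]))"


section \<open>The transition probabilities and the random sequence\<close>

definition qpoch :: "real \<Rightarrow> nat \<Rightarrow> real" where
  "qpoch q n = (\<Prod>k=1..n. 1 - q ^ k)"

definition P_col :: "nat \<Rightarrow> real \<Rightarrow> nat \<Rightarrow> nat list \<Rightarrow> nat list \<Rightarrow> real" where
  "P_col n q m c c' =
     of_bool (interlaces n m c c') * (-1) ^ n
     * q powi (int ((n * m + n + 1) choose 2) - int ((n * m + 1) choose 2) - int (xi n m c c'))
     * ((1 - q) ^ (n * m) / qpoch q n ^ (2 * m + 1))
     * (g_Delta n q (Suc m) c' (Q_vec n q (Suc m)) / g_Delta n q m c (Q_vec n q m))"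

text \<open>
  \<open>K\<close> is the Markov kernel on colour sequences, for the steps \<open>m < N\<close>, with the transition
  probabilities \<open>P_col\<close>. That these are non-negative and sum to 1 is expressed by the
  type of \<open>K\<close>: the distribution \<open>K m c\<close> lives on \<open>colour_seqs n (Suc m)\<close> and has the mass function
  \<open>P_col n q m c\<close> there.
\<close>

definition is_col_kernel ::
  "nat \<Rightarrow> real \<Rightarrow> nat \<Rightarrow> (nat \<Rightarrow> nat list \<Rightarrow> nat list pmf) \<Rightarrow> bool" where
  "is_col_kernel n q N K \<longleftrightarrow>
     (\<forall>m<N. \<forall>c\<in>colour_seqs n m.
        set_pmf (K m c) \<subseteq> colour_seqs n (Suc m) \<and>
        (\<forall>c'\<in>colour_seqs n (Suc m). pmf (K m c) c' = P_col n q m c c'))"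

text \<open>
  The joint law of the states \<open>[X\<^sub>0, ..., X\<^sub>N]\<close> of the (time-inhomogeneous) Markov chain started at
  \<open>s\<close>, whose step from time \<open>m\<close> to time \<open>m + 1\<close> is governed by \<open>K m\<close>.
\<close>

primrec trajectory_pmf :: "(nat \<Rightarrow> 'a \<Rightarrow> 'a pmf) \<Rightarrow> 'a \<Rightarrow> nat \<Rightarrow> 'a list pmf" where
  "trajectory_pmf K s 0 = return_pmf [s]"
| "trajectory_pmf K s (Suc m) =
     bind_pmf (trajectory_pmf K s m) (\<lambda>cs. map_pmf (\<lambda>c. cs @ [c]) (K m (last cs)))"

end

theory Submission
  imports Defs
begin

text \<open>
  The joint law is a product of transition probabilities, in which the ratios of the functions
  \<open>g\<^sub>\<Delta>\<close> telescope. The denominators are nonzero because \<open>K\<close> is a kernel of probability measures: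
  if \<open>g\<^sub>\<Delta>\<close> vanished at \<open>c\<close>, then all the weights \<open>P_col n q m c c'\<close> would be \<open>0\<close> and could not sum
  to 1. The first step carries no indicator, since every colour sequence interlaces with the
  empty one.
\<close>

text \<open>The list \<open>cs @ [c]\<close> determines its prefix and its last entry, so only the
  trajectory \<open>cs\<close> contributes to the bind.\<close>

lemma pmf_trajectory_pmf_Suc:
  "pmf (trajectory_pmf K s (Suc m)) (cs @ [c]) =
    pmf (trajectory_pmf K s m) cs * pmf (K m (last cs)) c"
proof -
  \<comment> \<open>The indicator turns the expectation over \<open>ds\<close> into the mass of the
    singleton \<open>{cs}\<close>.\<close>
  have step: "pmf (map_pmf (\<lambda>c. ds @ [c]) (K m (last ds))) (cs @ [c]) =
      pmf (K m (last cs)) c * indicator {cs} ds" for ds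
  proof (cases "ds = cs")
    case True
    have "inj (\<lambda>c. cs @ [c])"
      by (simp add: inj_on_def)
    then show ?thesis
      using True pmf_map_inj'[of "\<lambda>c. cs @ [c]" "K m (last cs)" c] by simp
  next
    case False
    then have "cs @ [c] \<notin> set_pmf (map_pmf (\<lambda>c. ds @ [c]) (K m (last ds)))"
      by auto
    then show ?thesis
      using False by (simp add: pmf_eq_0_set_pmf)
  qed
  show ?thesis
    by (simp add: pmf_bind step measure_pmf_single)
qed

lemma colour_seqs_0 [simp]: "colour_seqs n 0 = {[]}"
  by (auto simp: colour_seqs_def)

lemma g_Delta_0 [simp]: "g_Delta n q 0 \<sigma> x = 1"
proof -
  have "edge_configs n 0 \<sigma> = {(\<lambda>_. undefined, \<lambda>_. undefined)}"
    by (simp add: edge_configs_def set_eq_iff)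
  then show ?thesis
    by (simp add: g_Delta_def)
qed

text \<open>For \<open>m = 0\<close> each bundle is a single top arrow, so interlacing only asks
  that each colour occur exactly once.\<close>

lemma interlaces_0:
  assumes "c \<in> colour_seqs n 1"
  shows "interlaces n 0 [] c"
proof -
  have len: "length c = n" and cnt: "\<And>a. a \<in> {1..n} \<Longrightarrow> count_list c a = 1"
    using assms by (auto simp: colour_seqs_def)
  have top: "is_top 0 p" for p
    by (simp add: is_top_def)
  have col: "arrow_colour 0 [] c p = c ! p" for p
    by (simp add: arrow_colour_def top)
  show ?thesis
    unfolding interlaces_def
  proof
    fix a assume a: "a \<in> {1..n}"
    have "count_list (map ((!) c) [0..<n]) a = length (filter (\<lambda>p. a = c ! p) [0..<n])"
      by (simp only: count_list_eq_length_filter filter_map length_map comp_def)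
    then have "length (filter (\<lambda>p. c ! p = a) [0..<n]) = count_list c a"
      using len map_nth[of c] by (simp only: eq_commute[of a])
    then have "length (filter (\<lambda>p. c ! p = a) [0..<n]) = Suc 0"
      using cnt[OF a] by (simp only: One_nat_def)
    then obtain p where "filter (\<lambda>p. c ! p = a) [0..<n] = [p]"
      by (auto simp: length_Suc_conv)
    then show "map (is_top 0) (filter (\<lambda>p. arrow_colour 0 [] c p = a) [0..<n * (2 * 0 + 1)])
        = map even [0..<2 * 0 + 1]"
      by (simp add: col top)
  qed
qed

lemma g_Delta_nonzero:
  assumes "is_col_kernel n q N K" "m < N" "c \<in> colour_seqs n m"
  shows "g_Delta n q m c (Q_vec n q m) \<noteq> 0"
proof
  assume zero: "g_Delta n q m c (Q_vec n q m) = 0"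
  obtain c' where c': "c' \<in> set_pmf (K m c)"
    using set_pmf_not_empty[of "K m c"] by auto
  have "set_pmf (K m c) \<subseteq> colour_seqs n (Suc m)"
    and "\<And>c'. c' \<in> colour_seqs n (Suc m) \<Longrightarrow> pmf (K m c) c' = P_col n q m c c'"
    using assms by (auto simp: is_col_kernel_def)
  with c' have "pmf (K m c) c' = P_col n q m c c'"
    by blast
  \<comment> \<open>Division by zero yields 0 in HOL, so a vanishing denominator kills the weight of
    \<open>c'\<close>, although \<open>c'\<close> lies in the support.\<close>
  also have "\<dots> = 0"
    using zero by (simp add: P_col_def)
  finally show False
    using c' by (simp add: set_pmf_iff)
qed

text \<open>Splitting the exponent of \<open>q\<close> exhibits a second ratio of consecutive terms,
  which telescopes just as the ratio of the \<open>g_Delta\<close> does.\<close>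

lemma P_col_eq:
  assumes "q \<noteq> 0"
  shows "P_col n q m c c' = of_bool (interlaces n m c c') * (-1) ^ n
     * (q ^ ((n * Suc m + 1) choose 2) / q ^ ((n * m + 1) choose 2)) * q powi (- int (xi n m c c'))
     * ((1 - q) ^ (n * m) / qpoch q n ^ (2 * m + 1))
     * (g_Delta n q (Suc m) c' (Q_vec n q (Suc m)) / g_Delta n q m c (Q_vec n q m))"
proof -
  have "q powi (int a - int b - int x) = q ^ a / q ^ b * q powi (- int x)" for a b x
    using assms by (simp add: power_int_diff power_int_minus divide_inverse)
  moreover have "n * m + n + 1 = n * Suc m + 1"
    by simp
  ultimately show ?thesis
    unfolding P_col_def by (simp only: mult.assoc)
qed

text \<open>The induction runs over the number \<open>M\<close> of steps taken, while the horizon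
  \<open>N\<close> of the kernel stays fixed.\<close>

lemma pmf_trajectory_pmf_col:
  assumes q0: "q \<noteq> 0"
    and K: "is_col_kernel n q N K"
    and c: "\<And>k. k \<le> N \<Longrightarrow> c k \<in> colour_seqs n k"
    and "M \<le> N"
  shows "pmf (trajectory_pmf K [] M) (map c [0..<Suc M]) =
     of_bool (\<forall>i\<in>{1..<M}. interlaces n i (c i) (c (Suc i)))
     * (-1) ^ (n * M) * q ^ ((n * M + 1) choose 2)
     * ((1 - q) ^ (n * (M choose 2)) / qpoch q n ^ (M ^ 2))
     * g_Delta n q M (c M) (Q_vec n q M)
     * (\<Prod>i=1..M. q powi (- int (xi n (i - 1) (c (i - 1)) (c i))))"
  using \<open>M \<le> N\<close>
proof (induction M)
  case 0
  then show ?case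
    using c[of 0] by (simp add: numeral_2_eq_2)
next
  case (Suc M)
  have g: "g_Delta n q M (c M) (Q_vec n q M) \<noteq> 0"
    using g_Delta_nonzero[OF K] c Suc.prems by simp
  have "pmf (trajectory_pmf K [] (Suc M)) (map c [0..<Suc (Suc M)]) =
      pmf (trajectory_pmf K [] M) (map c [0..<Suc M]) * pmf (K M (c M)) (c (Suc M))"
    using pmf_trajectory_pmf_Suc[of K "[]" M "map c [0..<Suc M]" "c (Suc M)"] by simp
  also have "pmf (K M (c M)) (c (Suc M)) = P_col n q M (c M) (c (Suc M))"
    using K c Suc.prems by (simp add: is_col_kernel_def)
  finally have step: "pmf (trajectory_pmf K [] (Suc M)) (map c [0..<Suc (Suc M)]) =
      pmf (trajectory_pmf K [] M) (map c [0..<Suc M]) * P_col n q M (c M) (c (Suc M))" .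
  \<comment> \<open>The range starts at 1, so the first step adds a factor without adding an index;
    by \<open>interlaces_0\<close> that factor is 1.\<close>
  have ind: "of_bool (\<forall>i\<in>{1..<Suc M}. interlaces n i (c i) (c (Suc i))) =
      (of_bool (\<forall>i\<in>{1..<M}. interlaces n i (c i) (c (Suc i)))
       * of_bool (interlaces n M (c M) (c (Suc M))) :: real)"
  proof (cases "M = 0")
    case True
    then show ?thesis
      using c[of 0] c[of 1] Suc.prems interlaces_0[of "c 1" n] by simp
  next
    case False
    then show ?thesis
      by (auto simp: atLeastLessThanSuc)
  qed
  have sgn: "(-1::real) ^ (n * Suc M) = (-1) ^ (n * M) * (-1) ^ n"
    by (simp add: power_add)
  \<comment> \<open>Pascal's rule; writing 2 as a successor lets the recursion for binomial
    coefficients apply.\<close>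
  have one: "(1 - q) ^ (n * (Suc M choose 2)) = (1 - q) ^ (n * (M choose 2)) * (1 - q) ^ (n * M)"
    by (simp add: numeral_2_eq_2 distrib_left power_add)
  have "(Suc M)\<^sup>2 = M\<^sup>2 + (2 * M + 1)"
    by (simp add: power2_eq_square)
  then have poch: "qpoch q n ^ ((Suc M)\<^sup>2) = qpoch q n ^ (M\<^sup>2) * qpoch q n ^ (2 * M + 1)"
    by (simp only: power_add)
  have prd: "(\<Prod>i=1..Suc M. q powi (- int (xi n (i - 1) (c (i - 1)) (c i)))) =
      (\<Prod>i=1..M. q powi (- int (xi n (i - 1) (c (i - 1)) (c i))))
      * q powi (- int (xi n M (c M) (c (Suc M))))"
    by simp
  \<comment> \<open>Regrouping for arbitrary reals puts each old value next to its ratio: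
    \<open>Q * R\<close> and \<open>G * H\<close> both take the form \<open>x * (y / x)\<close> and
    collapse to \<open>y\<close>.\<close>
  have cancel: "(I * s * Q * (a / b) * G * p) * (J * t * R * x * (a' / b') * H)
      = (I * J) * (s * t) * (Q * R) * ((a * a') / (b * b')) * (G * H) * (p * x)"
    for I s Q a b G p J t R x a' b' H :: real
    unfolding times_divide_times_eq[symmetric] by (simp only: mult_ac)
  have ratio: "x * (y / x) = y" if "x \<noteq> 0" for x y :: real
    using that by simp
  have qn: "q ^ ((n * M + 1) choose 2) \<noteq> 0"
    using q0 by simp
  show ?case
    unfolding step P_col_eq[OF q0] Suc.IH[OF Suc_leD[OF Suc.prems]] ind sgn one poch prd
    by (simp only: cancel ratio[OF qn] ratio[OF g])
qed

theorem corollary1p7: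
  fixes n N :: nat and q :: real
    and K :: "nat \<Rightarrow> nat list \<Rightarrow> nat list pmf"
    and c :: "nat \<Rightarrow> nat list"
  assumes "n \<ge> 1" and "N \<ge> 1" and "0 < q" and "q < 1"
    and "is_col_kernel n q N K"
    and "\<And>k. k \<le> N \<Longrightarrow> c k \<in> colour_seqs n k"
  shows "pmf (trajectory_pmf K [] N) (map c [0..<Suc N]) =
     of_bool (\<forall>i\<in>{1..<N}. interlaces n i (c i) (c (Suc i)))
     * (-1) ^ (n * N) * q ^ ((n * N + 1) choose 2)
     * ((1 - q) ^ (n * (N choose 2)) / qpoch q n ^ (N ^ 2))
     * g_Delta n q N (c N) (Q_vec n q N)
     * (\<Prod>i=1..N. q powi (- int (xi n (i - 1) (c (i - 1)) (c i))))"
  using pmf_trajectory_pmf_col[OF _ assms(5,6) order_refl] \<open>0 < q\<close> by simp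

end
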